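(* Let $N \geq 1$ be an integer. For every real $\alpha > 2(N-1)$, $$\lim_{n \to \infty} n^{\alpha+1-2N} \, \|\Psi_n^N\|_\alpha^2 = \frac{\Gamma(\alpha+2)\, \zeta(\alpha+1-2(N-1))}{((N-1)!)^2},$$ where $\Gamma$ is the Gamma function and $\zeta$ is the Riemann zeta function.
   Context: $\mathbb{D}$ is the open unit disc. For $\alpha > -1$ and $f$ holomorphic on $\mathbb{D}$, $\|f\|_\alpha^2 = (\alpha+1)\int_{\mathbb{D}} |f(z)|^2 (1-|z|^2)^\alpha \, dA(z)$, where $dA$ is Lebesgue area measure normalized so that $\mathbb{D}$ has measure $1$. For $n \in \mathbb{N}$, $\Psi_n^N(z) = \sum_{0 \leq k < n} \frac{1}{(z - e^{2\pi i k/n})^N}$. *)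

theory Defs
  imports "HOL-Analysis.Analysis"
begin

definition disc_area :: "complex measure" where
  "disc_area = uniform_measure lborel (ball 0 1)"

text \<open>
  The squared norm takes values in \<^typ>\<open>ennreal\<close>, since it may be infinite for a function that is
  holomorphic on the unit disc.  Values of \<open>f\<close> outside the disc are irrelevant because
  \<^const>\<open>disc_area\<close> vanishes there.  Meant for \<open>\<alpha> > -1\<close>.
\<close>
definition bergman_norm_sq :: "real \<Rightarrow> (complex \<Rightarrow> complex) \<Rightarrow> ennreal" where
  "bergman_norm_sq \<alpha> f =
     ennreal (\<alpha> + 1) * (\<integral>\<^sup>+ z. ennreal ((cmod (f z))\<^sup>2 * (1 - (cmod z)\<^sup>2) powr \<alpha>) \<partial>disc_area)"

definition Psi :: "nat \<Rightarrow> nat \<Rightarrow> complex \<Rightarrow> complex" where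
  "Psi N n z = (\<Sum>k<n. 1 / (z - exp (2 * of_real pi * \<i> * of_nat k / of_nat n)) ^ N)"

text \<open>
  The Riemann zeta function on the half-line \<open>s > 1\<close>, where the Dirichlet series converges.
  For \<open>s \<le> 1\<close> this is not the analytic continuation.
\<close>
definition zeta :: "real \<Rightarrow> real" where
  "zeta s = (\<Sum>k. 1 / real (Suc k) powr s)"

end

theory Submission
  imports Defs "HOL-Probability.Distribution_Functions"
begin

text \<open>
  Expanding each term of \<open>\<Psi>\<close> in a power series, the sum over the roots of unity kills every
  coefficient except those of \<open>z ^ (n m - N)\<close>. Monomials are orthogonal for any radial weight, so the
  norm is an explicit series of squared binomial coefficients times Beta values. After rescaling, the
  \<open>m\<close>-th term is \<open>m powr - (\<alpha> + 3 - 2 N)\<close> times a convergent sequence evaluated at \<open>n m - N\<close>, and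
  Tannery's theorem gives the limit.
\<close>

text \<open>Origin of the constants: at a large index \<open>k\<close> the squared binomial
  coefficient behaves like \<open>k ^ (2 * (N - 1))\<close> divided by the square of (N - 1)!, and
  \<alpha> + 1 times the Beta value like Gamma(\<alpha> + 2) k^(-\<alpha> - 1). Each surviving
  coefficient also carries a factor \<open>n\<close> from the sum over the roots, so
  \<open>n\<close> enters squared. With \<open>k\<close> close to a multiple of \<open>n\<close>
  this gives the power n^(2N - 1 - \<alpha>) that the theorem divides out, and \<alpha> > 2(N - 1)
  says precisely that the remaining series converges. The obstacle is that \<open>Psi N n\<close>
  has poles on the unit circle: its power series does not converge uniformly on the disc, and
  finiteness of the norm is not known beforehand. Hence Parseval's identity is stated in
  \<open>ennreal\<close> and obtained first for weights living on smaller discs. Polar coordinates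
  are replaced by two facts about area: rotation invariance and the uniform distribution of
  |z|^2.\<close>

section \<open>Lebesgue measure under translations and rotations\<close>

lemma nn_integral_lborel_translate:
  fixes a :: "'a::euclidean_space"
  assumes [measurable]: "h \<in> borel_measurable borel"
  shows "(\<integral>\<^sup>+ x. h (a + x) \<partial>lborel) = (\<integral>\<^sup>+ x. h x \<partial>lborel)"
proof -
  have "(\<integral>\<^sup>+ x. h x \<partial>lborel) = (\<integral>\<^sup>+ x. h x \<partial>distr lborel borel ((+) a))"
    by (simp only: lborel_distr_plus)
  also have "\<dots> = (\<integral>\<^sup>+ x. h (a + x) \<partial>lborel)"
    by (subst nn_integral_distr) auto
  finally show ?thesis by simp
qed

lemma emeasure_unit_disc: "emeasure lborel (ball (0::complex) 1) = ennreal pi"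
  by (simp add: emeasure_ball unit_ball_vol_2)

text \<open>
  Uniqueness of Haar measure: the image of \<^term>\<open>lborel\<close> under a rotation is translation invariant,
  hence a multiple of \<^term>\<open>lborel\<close>, and the multiple is 1 because the unit ball is mapped to itself.
\<close>
lemma nn_integral_lborel_rotate:
  fixes c :: complex
  assumes c: "cmod c = 1" and [measurable]: "h \<in> borel_measurable borel"
  shows "(\<integral>\<^sup>+ z. h (c * z) \<partial>lborel) = (\<integral>\<^sup>+ z. h z \<partial>lborel)"
proof -
  let ?B = "ball (0::complex) 1" and ?I = "indicator (ball (0::complex) 1) :: complex \<Rightarrow> ennreal"
  have [measurable]: "?B \<in> sets borel" by simp
  have [simp]: "c \<noteq> 0" using c by auto
  have [simp]: "c * (z / c) = z" for z by simp
  have Bpos: "emeasure lborel ?B \<noteq> 0" "emeasure lborel ?B \<noteq> \<infinity>"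
    by (auto simp: emeasure_unit_disc)
  \<comment> \<open>The double integral of h(c x + y) 1_B(y) is evaluated in two ways. The shift x
    -> x + y / c separates the variables into the left side; the shift y -> y - c x leaves h(y)
    1_B(y - c x), and a further shift in x reduces the indicator to -c x in B, that is, x in
    B.\<close>
  have "(\<integral>\<^sup>+ z. h (c * z) \<partial>lborel) * emeasure lborel ?B
      = (\<integral>\<^sup>+ y. (\<integral>\<^sup>+ x. h (c * x) * ?I y \<partial>lborel) \<partial>lborel)"
    by (simp add: nn_integral_cmult_indicator nn_integral_multc)
  also have "\<dots> = (\<integral>\<^sup>+ y. (\<integral>\<^sup>+ x. h (c * (y / c + x)) * ?I y \<partial>lborel) \<partial>lborel)"
    by (intro nn_integral_cong nn_integral_lborel_translate[symmetric]) measurable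
  also have "\<dots> = (\<integral>\<^sup>+ y. (\<integral>\<^sup>+ x. h (c * x + y) * ?I y \<partial>lborel) \<partial>lborel)"
    by (simp add: distrib_left add.commute)
  also have "\<dots> = (\<integral>\<^sup>+ x. (\<integral>\<^sup>+ y. h (c * x + y) * ?I y \<partial>lborel) \<partial>lborel)"
    by (rule lborel_pair.Fubini') measurable
  also have "\<dots> = (\<integral>\<^sup>+ x. (\<integral>\<^sup>+ y. h (c * x + (- c * x + y)) * ?I (- c * x + y) \<partial>lborel) \<partial>lborel)"
    by (intro nn_integral_cong nn_integral_lborel_translate[symmetric]) measurable
  also have "\<dots> = (\<integral>\<^sup>+ x. (\<integral>\<^sup>+ y. h y * ?I (- c * x + y) \<partial>lborel) \<partial>lborel)"
    by simp
  also have "\<dots> = (\<integral>\<^sup>+ y. (\<integral>\<^sup>+ x. h y * ?I (- c * x + y) \<partial>lborel) \<partial>lborel)"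
    by (rule lborel_pair.Fubini') measurable
  also have "\<dots> = (\<integral>\<^sup>+ y. (\<integral>\<^sup>+ x. h y * ?I (- c * (y / c + x) + y) \<partial>lborel) \<partial>lborel)"
    by (intro nn_integral_cong nn_integral_lborel_translate[symmetric]) measurable
  also have "\<dots> = (\<integral>\<^sup>+ y. (\<integral>\<^sup>+ x. h y * ?I x \<partial>lborel) \<partial>lborel)"
    using c by (intro nn_integral_cong) (auto simp: distrib_left indicator_def norm_mult)
  also have "\<dots> = (\<integral>\<^sup>+ z. h z \<partial>lborel) * emeasure lborel ?B"
    by (simp add: nn_integral_cmult nn_integral_multc)
  finally show ?thesis
    using Bpos by (metis ennreal_mult_cancel_left mult.commute infinity_ennreal_def)
qed

section \<open>Normalized area on the disc: orthogonality and radial moments\<close>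

lemma sets_disc_area [measurable_cong, simp]: "sets disc_area = sets borel"
  by (simp add: disc_area_def)

lemma space_disc_area [simp]: "space disc_area = UNIV"
  by (simp add: disc_area_def)

lemma prob_space_disc_area: "prob_space disc_area"
  unfolding disc_area_def by (rule prob_space_uniform_measure) (auto simp: emeasure_unit_disc)

lemma AE_disc_area: "AE z in disc_area. cmod z < 1"
  unfolding disc_area_def
  by (rule AE_uniform_measureI) auto

lemma disc_area_rotate:
  assumes c: "cmod c = 1"
  shows "distr disc_area borel ((*) c) = disc_area"
proof (rule measure_eqI)
  fix A assume "A \<in> sets (distr disc_area borel ((*) c))"
  hence [measurable]: "A \<in> sets borel" by simp
  have [measurable]: "ball (0::complex) 1 \<in> sets borel" by simp
  have "emeasure (distr disc_area borel ((*) c)) A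
      = (\<integral>\<^sup>+ z. indicator A z \<partial>distr disc_area borel ((*) c))"
    by simp
  also have "\<dots> = (\<integral>\<^sup>+ z. indicator A (c * z) \<partial>disc_area)"
    by (rule nn_integral_distr) auto
  also have "\<dots> = (\<integral>\<^sup>+ z. indicator A (c * z) * indicator (ball 0 1) (c * z) \<partial>lborel) / ennreal pi"
    using c unfolding disc_area_def
    by (subst nn_integral_uniform_measure)
      (auto simp: emeasure_unit_disc indicator_def norm_mult intro!: arg_cong2[where f = "(/)"] nn_integral_cong)
  also have "(\<integral>\<^sup>+ z. indicator A (c * z) * indicator (ball 0 1) (c * z) \<partial>lborel)
      = (\<integral>\<^sup>+ z. indicator A z * indicator (ball 0 1) z \<partial>lborel)"
    by (rule nn_integral_lborel_rotate[OF c]) measurable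
  also have "(\<integral>\<^sup>+ z. indicator A z * indicator (ball 0 1) z \<partial>lborel) / ennreal pi = emeasure disc_area A"
    unfolding disc_area_def
    by (subst nn_integral_indicator[symmetric], simp, subst nn_integral_uniform_measure)
      (auto simp: emeasure_unit_disc)
  finally show "emeasure (distr disc_area borel ((*) c)) A = emeasure disc_area A" .
qed simp

text \<open>The rotation by the angle pi / (j - k) multiplies z^j cnj(z)^k by e^(i pi) = -1 and
  fixes the radial factor, so the integral equals its own negative. No integrability enters, since
  each step also holds for the default value 0 of the Bochner integral.\<close>

lemma monomials_orthogonal:
  fixes u :: "real \<Rightarrow> real"
  assumes [measurable]: "u \<in> borel_measurable borel" and "j \<noteq> k"
  shows "(LINT z|disc_area. of_real (u (cmod z)) * (z ^ j * cnj z ^ k)) = 0" (is "?I = 0")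
proof -
  define c where "c = cis (pi / (real j - real k))"
  have c: "cmod c = 1" by (simp add: c_def)
  have "c ^ j * cnj c ^ k = cis (real j * (pi / (real j - real k)) - real k * (pi / (real j - real k)))"
    by (simp add: c_def Complex.DeMoivre cis_mult cis_cnj)
  also have "real j * (pi / (real j - real k)) - real k * (pi / (real j - real k)) = pi"
    using \<open>j \<noteq> k\<close> by (simp only: left_diff_distrib[symmetric]) simp
  finally have c_pow: "c ^ j * cnj c ^ k = - 1" by simp
  have [measurable]: "cnj \<in> borel_measurable borel"
    by (intro borel_measurable_continuous_onI continuous_intros)
  have "?I = (LINT z|distr disc_area borel ((*) c). of_real (u (cmod z)) * (z ^ j * cnj z ^ k))"
    by (simp only: disc_area_rotate[OF c])
  also have "\<dots> = (LINT z|disc_area. of_real (u (cmod (c * z))) * ((c * z) ^ j * cnj (c * z) ^ k))"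
    by (rule integral_distr) measurable
  also have "\<dots> = (LINT z|disc_area. (c ^ j * cnj c ^ k) * (of_real (u (cmod z)) * (z ^ j * cnj z ^ k)))"
    using c by (intro Bochner_Integration.integral_cong) (auto simp: norm_mult power_mult_distrib)
  also have "\<dots> = - ?I" by (simp add: c_pow)
  finally show ?thesis by simp
qed

text \<open>The disc of radius \<open>sqrt t\<close> has normalized area \<open>t\<close>, so the
  two distribution functions agree. This turns every radial integral into one over the unit
  interval.\<close>

lemma disc_area_norm_square_uniform:
  "distr disc_area borel (\<lambda>z. (cmod z)\<^sup>2) = uniform_measure lborel {0..1}"
proof (rule cdf_unique)
  interpret D: prob_space disc_area by (rule prob_space_disc_area)
  show "real_distribution (distr disc_area borel (\<lambda>z. (cmod z)\<^sup>2))"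
    by (rule D.real_distribution_distr) measurable
  interpret U: prob_space "uniform_measure lborel {0..1::real}"
    by (rule prob_space_uniform_measure) auto
  show "real_distribution (uniform_measure lborel {0..1})"
    by unfold_locales auto
  show "cdf (distr disc_area borel (\<lambda>z. (cmod z)\<^sup>2)) = cdf (uniform_measure lborel {0..1})"
  proof
    fix t :: real
    have "emeasure (distr disc_area borel (\<lambda>z. (cmod z)\<^sup>2)) {..t}
        = emeasure lborel (ball 0 1 \<inter> {z. (cmod z)\<^sup>2 \<le> t}) / ennreal pi"
      unfolding disc_area_def
      by (subst emeasure_distr) (auto simp: emeasure_unit_disc vimage_def)
    also have "\<dots> = ennreal (max 0 (min 1 t))"
    proof -
      consider "t < 0" | "0 \<le> t" "t < 1" | "1 \<le> t" by linarith
      thus ?thesis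
      proof cases
        case 1
        hence "ball 0 1 \<inter> {z::complex. (cmod z)\<^sup>2 \<le> t} = {}"
          using zero_le_power2 by (smt (verit) Collect_empty_eq inf_bot_right)
        thus ?thesis using 1 by simp
      next
        case 2
        hence "ball 0 1 \<inter> {z::complex. (cmod z)\<^sup>2 \<le> t} = cball 0 (sqrt t)"
          by (auto simp: real_le_rsqrt) (smt (verit) real_sqrt_lt_1_iff, metis norm_ge_zero real_le_lsqrt sqrt_ge_absD abs_norm_cancel power2_abs)
        thus ?thesis using 2
          by (simp add: emeasure_cball unit_ball_vol_2 divide_ennreal)
      next
        case 3
        hence "ball 0 1 \<inter> {z::complex. (cmod z)\<^sup>2 \<le> t} = ball 0 1"
          by (auto simp: abs_square_le_1 intro: order_trans[of _ 1])
        thus ?thesis using 3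
          by (simp add: emeasure_unit_disc divide_ennreal)
      qed
    qed
    also have "\<dots> = emeasure (uniform_measure lborel {0..1}) {..t}"
    proof -
      have "{0..1} \<inter> {..t} = {0..min 1 t}" by auto
      thus ?thesis by (cases "0 \<le> t") (auto simp: min_def divide_ennreal_def)
    qed
    finally show "cdf (distr disc_area borel (\<lambda>z. (cmod z)\<^sup>2)) t = cdf (uniform_measure lborel {0..1}) t"
      by (simp add: cdf_def measure_def)
  qed
qed

lemma disc_moment:
  assumes "\<alpha> > - 1"
  shows "(\<integral>\<^sup>+ z. ennreal ((cmod z) ^ (2 * j) * (1 - (cmod z)\<^sup>2) powr \<alpha>) \<partial>disc_area)
       = ennreal (Beta (real j + 1) (\<alpha> + 1))"
proof -
  have "(\<integral>\<^sup>+ z. ennreal ((cmod z) ^ (2 * j) * (1 - (cmod z)\<^sup>2) powr \<alpha>) \<partial>disc_area)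
      = (\<integral>\<^sup>+ t. ennreal (t ^ j * (1 - t) powr \<alpha>) \<partial>distr disc_area borel (\<lambda>z. (cmod z)\<^sup>2))"
    by (subst nn_integral_distr) (auto simp: power_mult)
  also have "\<dots> = (\<integral>\<^sup>+ t. ennreal (t ^ j * (1 - t) powr \<alpha>) * indicator {0..1} t \<partial>lborel)"
    unfolding disc_area_norm_square_uniform
    by (subst nn_integral_uniform_measure) (auto simp: divide_ennreal_def)
  also have "\<dots> = (\<integral>\<^sup>+ t. ennreal (t powr (real j + 1 - 1) * (1 - t) powr (\<alpha> + 1 - 1)) * indicator {0..1} t \<partial>lborel)"
  proof (rule nn_integral_cong_AE)
    \<comment> \<open>The point 0 is excluded because for \<open>j = 0\<close> the power
      \<open>0 ^ 0\<close> is 1 whereas \<open>0 powr 0\<close> is 0.\<close>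
    have "AE t in lborel. t \<noteq> (0::real)" by (rule AE_lborel_singleton)
    thus "AE t in lborel. ennreal (t ^ j * (1 - t) powr \<alpha>) * indicator {0..1} t =
      ennreal (t powr (real j + 1 - 1) * (1 - t) powr (\<alpha> + 1 - 1)) * indicator {0..1} t"
      by eventually_elim (auto simp: powr_realpow indicator_def)
  qed
  also have "\<dots> = ennreal (Beta (real j + 1) (\<alpha> + 1))"
    using assms
    by (intro trans[OF _ nn_integral_has_integral_lebesgue[OF _ has_integral_Beta_real]] nn_integral_cong)
      (auto simp: indicator_def)
  finally show ?thesis .
qed

section \<open>Parseval's identity for radial weights\<close>

lemma norm_partial_sum_le:
  fixes a :: "nat \<Rightarrow> complex"
  assumes "summable (\<lambda>j. norm (a j) * r ^ j)" "cmod z \<le> r"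
  shows "cmod (\<Sum>j<K. a j * z ^ j) \<le> (\<Sum>j. norm (a j) * r ^ j)"
proof -
  have r: "0 \<le> r" using assms(2) norm_ge_zero order_trans by blast
  have "cmod (\<Sum>j<K. a j * z ^ j) \<le> (\<Sum>j<K. norm (a j) * r ^ j)"
    using assms(2) by (intro sum_norm_le) (auto simp: norm_mult norm_power intro!: mult_left_mono power_mono)
  also have "\<dots> \<le> (\<Sum>j. norm (a j) * r ^ j)"
    using assms(1) r by (intro sum_le_suminf) auto
  finally show ?thesis .
qed

text \<open>The square is expanded as the sum times its conjugate, and orthogonality leaves the
  diagonal. Boundedness of \<open>u\<close> and its vanishing beyond 1 make every product
  integrable, which is what allows the integral to be split.\<close>

lemma norm_square_partial_sum_integral:
  fixes a :: "nat \<Rightarrow> complex"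
  assumes [measurable]: "u \<in> borel_measurable borel"
    and u: "\<And>x. 0 \<le> u x" "\<And>x. u x \<le> C" "\<And>x. u x \<noteq> 0 \<Longrightarrow> x \<le> 1"
  shows "(LINT z|disc_area. (cmod (\<Sum>j<K. a j * z ^ j))\<^sup>2 * u (cmod z))
       = (\<Sum>j<K. (cmod (a j))\<^sup>2 * (LINT z|disc_area. (cmod z) ^ (2 * j) * u (cmod z)))"
proof -
  interpret D: prob_space disc_area by (rule prob_space_disc_area)
  have [measurable]: "cnj \<in> borel_measurable borel"
    by (intro borel_measurable_continuous_onI continuous_intros)
  have int: "integrable disc_area (\<lambda>z. of_real (u (cmod z)) * (z ^ j * cnj z ^ k))" for j k
  proof (rule D.integrable_const_bound[where B = C])
    have "cmod (of_real (u (cmod z)) * (z ^ j * cnj z ^ k)) \<le> C" for z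
    proof (cases "u (cmod z) = 0")
      case False
      hence "cmod z \<le> 1" using u by blast
      hence "u (cmod z) * (cmod z ^ j * cmod z ^ k) \<le> C * (1 * 1)"
        using u order_trans[OF u(1) u(2)] by (intro mult_mono power_le_one) auto
      thus ?thesis using u by (simp add: norm_mult norm_power)
    qed (use order_trans[OF u(1) u(2)] in auto)
    thus "AE z in disc_area. cmod (of_real (u (cmod z)) * (z ^ j * cnj z ^ k)) \<le> C" by simp
  qed measurable
  have expand: "complex_of_real ((cmod (\<Sum>j<K. a j * z ^ j))\<^sup>2 * u (cmod z))
      = (\<Sum>j<K. \<Sum>k<K. a j * cnj (a k) * (of_real (u (cmod z)) * (z ^ j * cnj z ^ k)))" for z
    by (simp add: complex_norm_square sum_distrib_left sum_distrib_right mult_ac del: of_real_power)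
      (rule sum.swap)
  have moment: "(LINT z|disc_area. of_real (u (cmod z)) * (z ^ j * cnj z ^ j))
      = complex_of_real (LINT z|disc_area. (cmod z) ^ (2 * j) * u (cmod z))" for j
  proof (subst integral_complex_of_real[symmetric], intro Bochner_Integration.integral_cong refl)
    fix z
    have "complex_of_real ((cmod z) ^ (2 * j)) = z ^ j * cnj z ^ j"
      using complex_norm_square[of "z ^ j"] by (simp add: norm_power power_mult[symmetric] mult.commute)
    thus "of_real (u (cmod z)) * (z ^ j * cnj z ^ j) = complex_of_real ((cmod z) ^ (2 * j) * u (cmod z))"
      by (simp only: of_real_mult mult.commute)
  qed
  have "complex_of_real (LINT z|disc_area. (cmod (\<Sum>j<K. a j * z ^ j))\<^sup>2 * u (cmod z))
      = (LINT z|disc_area. complex_of_real ((cmod (\<Sum>j<K. a j * z ^ j))\<^sup>2 * u (cmod z)))"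
    by (rule integral_complex_of_real[symmetric])
  also have "\<dots> = (\<Sum>j<K. \<Sum>k<K. a j * cnj (a k) *
      (LINT z|disc_area. of_real (u (cmod z)) * (z ^ j * cnj z ^ k)))"
    unfolding expand using int by simp
  also have "\<dots> = (\<Sum>j<K. \<Sum>k<K. if k = j then
      of_real ((cmod (a j))\<^sup>2) * (LINT z|disc_area. of_real (u (cmod z)) * (z ^ j * cnj z ^ j)) else 0)"
    by (intro sum.cong refl) (auto simp: monomials_orthogonal complex_norm_square simp del: of_real_power)
  also have "\<dots> = (\<Sum>j<K. of_real ((cmod (a j))\<^sup>2) * (LINT z|disc_area. of_real (u (cmod z)) * (z ^ j * cnj z ^ j)))"
    by simp
  also have "\<dots> = (\<Sum>j<K. of_real ((cmod (a j))\<^sup>2) * of_real (LINT z|disc_area. (cmod z) ^ (2 * j) * u (cmod z)))"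
    by (simp only: moment)
  also have "\<dots> = of_real (\<Sum>j<K. (cmod (a j))\<^sup>2 * (LINT z|disc_area. (cmod z) ^ (2 * j) * u (cmod z)))"
    by simp
  finally show ?thesis by (simp only: of_real_eq_iff)
qed

text \<open>A weight that vanishes beyond a radius \<open>r < 1\<close> only sees points where all
  partial sums are bounded by the same constant \<open>S\<close>. Dominated convergence with the
  constant S^2 C then carries the identity from partial sums to the full series.\<close>

lemma parseval_disc_bounded:
  fixes a :: "nat \<Rightarrow> complex"
  assumes summable: "\<And>z. cmod z < 1 \<Longrightarrow> summable (\<lambda>j. a j * z ^ j)"
    and [measurable]: "u \<in> borel_measurable borel"
    and u: "\<And>x. 0 \<le> u x" "\<And>x. u x \<le> C" "\<And>x. u x \<noteq> 0 \<Longrightarrow> x \<le> r" and r: "0 \<le> r" "r < 1"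
  shows "(\<integral>\<^sup>+ z. ennreal ((cmod (\<Sum>j. a j * z ^ j))\<^sup>2 * u (cmod z)) \<partial>disc_area)
       = (\<Sum>j. ennreal ((cmod (a j))\<^sup>2) * (\<integral>\<^sup>+ z. ennreal ((cmod z) ^ (2 * j) * u (cmod z)) \<partial>disc_area))"
proof -
  interpret D: prob_space disc_area by (rule prob_space_disc_area)
  define S where "S = (\<Sum>j. norm (a j) * r ^ j)"
  define F where "F z = (\<Sum>j. a j * z ^ j)" for z
  have C: "0 \<le> C" using u(1,2) order_trans by blast
  have [measurable]: "F \<in> borel_measurable borel" unfolding F_def by measurable
  have norm_summable: "summable (\<lambda>j. norm (a j) * r ^ j)"
  proof -
    have "summable (\<lambda>j. norm (a j * of_real r ^ j))"
    proof (rule powser_insidea)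
      \<comment> \<open>The midpoint of \<open>r\<close> and 1 is still inside the disc of
        convergence, and convergence there forces absolute convergence at the smaller radius
        \<open>r\<close>.\<close>
      show "summable (\<lambda>j. a j * of_real ((1 + r) / 2) ^ j)"
        using r by (intro summable) (simp del: of_real_add of_real_divide)
      show "norm (of_real r :: complex) < norm (of_real ((1 + r) / 2) :: complex)"
        using r by (simp del: of_real_add of_real_divide)
    qed
    thus ?thesis using r by (simp add: norm_mult norm_power)
  qed
  have bound: "(cmod w)\<^sup>2 * u (cmod z) \<le> S\<^sup>2 * C" if "cmod z \<le> r \<Longrightarrow> cmod w \<le> S" for w z
  proof (cases "u (cmod z) = 0")
    case False
    thus ?thesis using u(1,2) u(3)[OF False] that by (intro mult_mono power_mono) auto
  qed (use C in auto)
  have lim: "(\<lambda>K. \<Sum>j<K. a j * z ^ j) \<longlonglongrightarrow> F z" if "cmod z < 1" for z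
    using summable[OF that] unfolding F_def by (rule summable_LIMSEQ)
  have lim': "(\<lambda>K. (cmod (\<Sum>j<K. a j * z ^ j))\<^sup>2 * u (cmod z)) \<longlonglongrightarrow> (cmod (F z))\<^sup>2 * u (cmod z)" if "cmod z < 1" for z
    by (intro tendsto_intros lim that)
  have bnd: "norm ((cmod (\<Sum>j<K. a j * z ^ j))\<^sup>2 * u (cmod z)) \<le> S\<^sup>2 * C" for z K
    using bound[of z "\<Sum>j<K. a j * z ^ j"] norm_partial_sum_le[OF norm_summable, of z K] u(1)
    by (simp add: S_def)
  have intF: "integrable disc_area (\<lambda>z. (cmod (F z))\<^sup>2 * u (cmod z))"
    and limI: "(\<lambda>K. LINT z|disc_area. (cmod (\<Sum>j<K. a j * z ^ j))\<^sup>2 * u (cmod z))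
       \<longlonglongrightarrow> (LINT z|disc_area. (cmod (F z))\<^sup>2 * u (cmod z))"
  proof -
    have 1: "AE z in disc_area. (\<lambda>K. (cmod (\<Sum>j<K. a j * z ^ j))\<^sup>2 * u (cmod z)) \<longlonglongrightarrow> (cmod (F z))\<^sup>2 * u (cmod z)"
      using AE_disc_area by eventually_elim (rule lim')
    show "integrable disc_area (\<lambda>z. (cmod (F z))\<^sup>2 * u (cmod z))"
      by (rule integrable_dominated_convergence[where w = "\<lambda>_. S\<^sup>2 * C"]) (use 1 bnd in auto)
    show "(\<lambda>K. LINT z|disc_area. (cmod (\<Sum>j<K. a j * z ^ j))\<^sup>2 * u (cmod z))
       \<longlonglongrightarrow> (LINT z|disc_area. (cmod (F z))\<^sup>2 * u (cmod z))"
      by (rule integral_dominated_convergence[where w = "\<lambda>_. S\<^sup>2 * C"]) (use 1 bnd in auto)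
  qed
  have intm: "integrable disc_area (\<lambda>z. (cmod z) ^ (2 * j) * u (cmod z))" for j
  proof (rule D.integrable_const_bound[where B = C])
    have "norm ((cmod z) ^ (2 * j) * u (cmod z)) \<le> C" for z
    proof (cases "u (cmod z) = 0")
      case False
      hence "cmod z \<le> 1" using u(3) r by fastforce
      hence "(cmod z) ^ (2 * j) * u (cmod z) \<le> 1 * C"
        using u C by (intro mult_mono power_le_one) auto
      thus ?thesis using u by simp
    qed (use C in auto)
    thus "AE z in disc_area. norm ((cmod z) ^ (2 * j) * u (cmod z)) \<le> C" by simp
  qed measurable
  have "x \<le> 1" if "u x \<noteq> 0" for x
    using u(3)[OF that] r by simp
  with u limI have "(\<lambda>j. (cmod (a j))\<^sup>2 * (LINT z|disc_area. (cmod z) ^ (2 * j) * u (cmod z)))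
      sums (LINT z|disc_area. (cmod (F z))\<^sup>2 * u (cmod z))"
    by (simp add: sums_def norm_square_partial_sum_integral[where C = C])
  hence "(\<Sum>j. ennreal ((cmod (a j))\<^sup>2 * (LINT z|disc_area. (cmod z) ^ (2 * j) * u (cmod z))))
      = ennreal (LINT z|disc_area. (cmod (F z))\<^sup>2 * u (cmod z))"
    using u by (intro suminf_ennreal_eq) auto
  also have "\<dots> = (\<integral>\<^sup>+ z. ennreal ((cmod (F z))\<^sup>2 * u (cmod z)) \<partial>disc_area)"
    using u intF by (intro nn_integral_eq_integral[symmetric]) auto
  finally have series: "(\<Sum>j. ennreal ((cmod (a j))\<^sup>2 * (LINT z|disc_area. (cmod z) ^ (2 * j) * u (cmod z))))
      = (\<integral>\<^sup>+ z. ennreal ((cmod (F z))\<^sup>2 * u (cmod z)) \<partial>disc_area)" .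
  have "ennreal ((cmod (a j))\<^sup>2 * (LINT z|disc_area. (cmod z) ^ (2 * j) * u (cmod z)))
      = ennreal ((cmod (a j))\<^sup>2) * (\<integral>\<^sup>+ z. ennreal ((cmod z) ^ (2 * j) * u (cmod z)) \<partial>disc_area)" for j
    using u by (subst nn_integral_eq_integral[OF intm]) (auto intro!: ennreal_mult)
  with series show ?thesis by (simp only: F_def)
qed

text \<open>Monotone convergence lifts the restrictions on the weight, on both sides at once. Since
  everything is \<open>ennreal\<close>-valued, the identity also covers the case where both sides
  are infinite.\<close>

lemma parseval_disc:
  fixes a :: "nat \<Rightarrow> complex"
  assumes summable: "\<And>z. cmod z < 1 \<Longrightarrow> summable (\<lambda>j. a j * z ^ j)"
    and [measurable]: "u \<in> borel_measurable borel" and u: "\<And>x. 0 \<le> u x"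
  shows "(\<integral>\<^sup>+ z. ennreal ((cmod (\<Sum>j. a j * z ^ j))\<^sup>2 * u (cmod z)) \<partial>disc_area)
       = (\<Sum>j. ennreal ((cmod (a j))\<^sup>2) * (\<integral>\<^sup>+ z. ennreal ((cmod z) ^ (2 * j) * u (cmod z)) \<partial>disc_area))"
proof -
  \<comment> \<open>Truncating the weight in size and support makes dominated convergence available.\<close>
  define v where "v n x = (if x \<le> 1 - 1 / real (Suc n) \<and> u x \<le> real n then u x else 0)" for n x
  have [measurable]: "v n \<in> borel_measurable borel" for n
    unfolding v_def by measurable
  have v0: "0 \<le> v n x" for n x using u by (simp add: v_def)
  have inc: "v m x \<le> v n x" if "m \<le> n" for m n x
  proof -
    have "1 / real (Suc n) \<le> 1 / real (Suc m)" using that by (intro divide_left_mono) auto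
    thus ?thesis using that u by (auto simp: v_def)
  qed
  have v1: "v n x = 0" if "\<not> x < 1" for n x
  proof -
    have "0 < 1 / real (Suc n)" by simp
    hence "\<not> x \<le> 1 - 1 / real (Suc n)" using that by linarith
    thus ?thesis by (simp add: v_def)
  qed
  have ev: "\<forall>\<^sub>F n in sequentially. v n x = u x" if "x < 1" for x
  proof -
    have "\<forall>\<^sub>F n in sequentially. 1 / real (Suc n) < 1 - x"
      using LIMSEQ_Suc[OF lim_1_over_n] by (rule order_tendstoD(2)) (use that in simp)
    moreover have "\<forall>\<^sub>F n in sequentially. u x \<le> real n"
      using eventually_ge_at_top[of "nat \<lceil>u x\<rceil>"] by eventually_elim linarith
    ultimately show ?thesis by eventually_elim (auto simp: v_def)
  qed
  have lim: "(\<lambda>n. \<integral>\<^sup>+ z. ennreal (g z * v n (cmod z)) \<partial>disc_area)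
      \<longlonglongrightarrow> (\<integral>\<^sup>+ z. ennreal (g z * u (cmod z)) \<partial>disc_area)"
    if [measurable]: "g \<in> borel_measurable borel" and g: "\<And>z. 0 \<le> g z" for g
  proof -
    \<comment> \<open>The pointwise limit of \<open>v n\<close> is \<open>u\<close> cut off outside
      the open disc, which agrees with \<open>u\<close> almost everywhere for
      \<open>disc_area\<close>.\<close>
    have "(\<lambda>n. \<integral>\<^sup>+ z. ennreal (g z * v n (cmod z)) \<partial>disc_area)
        \<longlonglongrightarrow> (\<integral>\<^sup>+ z. ennreal (g z * (if cmod z < 1 then u (cmod z) else 0)) \<partial>disc_area)"
    proof (rule nn_integral_LIMSEQ)
      show "incseq (\<lambda>n z. ennreal (g z * v n (cmod z)))"
        using inc g by (auto simp: incseq_def le_fun_def intro!: ennreal_leI mult_left_mono)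
      show "(\<lambda>n. ennreal (g z * v n (cmod z)))
          \<longlonglongrightarrow> ennreal (g z * (if cmod z < 1 then u (cmod z) else 0))" for z
        by (rule tendsto_eventually) (cases "cmod z < 1"; auto intro!: eventually_mono[OF ev] simp: v1)
    qed measurable
    also have "(\<integral>\<^sup>+ z. ennreal (g z * (if cmod z < 1 then u (cmod z) else 0)) \<partial>disc_area)
        = (\<integral>\<^sup>+ z. ennreal (g z * u (cmod z)) \<partial>disc_area)"
      by (rule nn_integral_cong_AE) (use AE_disc_area in \<open>eventually_elim, simp\<close>)
    finally show ?thesis .
  qed
  \<comment> \<open>The series is read as an integral over counting measure, so that monotone
    convergence applies to it as well.\<close>
  have "(\<lambda>n. \<integral>\<^sup>+ j. ennreal ((cmod (a j))\<^sup>2) * (\<integral>\<^sup>+ z. ennreal ((cmod z) ^ (2 * j) * v n (cmod z)) \<partial>disc_area)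
        \<partial>count_space UNIV)
      \<longlonglongrightarrow> (\<integral>\<^sup>+ j. ennreal ((cmod (a j))\<^sup>2) * (\<integral>\<^sup>+ z. ennreal ((cmod z) ^ (2 * j) * u (cmod z)) \<partial>disc_area)
        \<partial>count_space UNIV)"
  proof (rule nn_integral_LIMSEQ)
    show "incseq (\<lambda>n j. ennreal ((cmod (a j))\<^sup>2) * (\<integral>\<^sup>+ z. ennreal ((cmod z) ^ (2 * j) * v n (cmod z)) \<partial>disc_area))"
      using inc by (auto simp: incseq_def le_fun_def intro!: mult_left_mono nn_integral_mono ennreal_leI)
    show "(\<lambda>n. ennreal ((cmod (a j))\<^sup>2) * (\<integral>\<^sup>+ z. ennreal ((cmod z) ^ (2 * j) * v n (cmod z)) \<partial>disc_area))
        \<longlonglongrightarrow> ennreal ((cmod (a j))\<^sup>2) * (\<integral>\<^sup>+ z. ennreal ((cmod z) ^ (2 * j) * u (cmod z)) \<partial>disc_area)" for j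
      by (intro ennreal_tendsto_cmult lim) auto
  qed simp
  moreover have "(\<integral>\<^sup>+ z. ennreal ((cmod (\<Sum>j. a j * z ^ j))\<^sup>2 * v n (cmod z)) \<partial>disc_area)
      = (\<integral>\<^sup>+ j. ennreal ((cmod (a j))\<^sup>2) * (\<integral>\<^sup>+ z. ennreal ((cmod z) ^ (2 * j) * v n (cmod z)) \<partial>disc_area)
        \<partial>count_space UNIV)" for n
    unfolding nn_integral_count_space_nat
    by (rule parseval_disc_bounded[where C = "real n" and r = "1 - 1 / real (Suc n)"])
      (auto simp: summable v0, auto simp: v_def split: if_splits)
  ultimately have "(\<lambda>n. \<integral>\<^sup>+ z. ennreal ((cmod (\<Sum>j. a j * z ^ j))\<^sup>2 * v n (cmod z)) \<partial>disc_area)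
      \<longlonglongrightarrow> (\<Sum>j. ennreal ((cmod (a j))\<^sup>2) * (\<integral>\<^sup>+ z. ennreal ((cmod z) ^ (2 * j) * u (cmod z)) \<partial>disc_area))"
    by (simp add: nn_integral_count_space_nat)
  thus ?thesis
    by (rule LIMSEQ_unique[rotated]) (rule lim, auto)
qed

section \<open>Power series of \<open>Psi\<close>\<close>

text \<open>Exchanging the roles of \<open>k\<close> and \<open>p\<close> in the exponent turns the
  sum into a geometric one with ratio \<open>q\<close>, where \<open>q ^ n = 1\<close>. It vanishes
  unless \<open>q = 1\<close>, which means that \<open>n\<close> divides \<open>p\<close>.\<close>

lemma sum_root_of_unity_inverse_powers:
  assumes "0 < n"
  shows "(\<Sum>k<n. inverse (exp (2 * of_real pi * \<i> * of_nat k / of_nat n)) ^ p)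
       = (if n dvd p then of_nat n else 0 :: complex)"
proof -
  define q :: complex where "q = inverse (exp (2 * of_real pi * \<i> * of_nat p / of_nat n))"
  have q: "inverse (exp (2 * of_real pi * \<i> * of_nat k / of_nat n)) ^ p = q ^ k" for k
  proof -
    have "exp (2 * of_real pi * \<i> * of_nat k / of_nat n) ^ p
        = exp (of_nat p * (2 * of_real pi * \<i> * of_nat k / of_nat n) :: complex)"
      by (rule exp_of_nat_mult[symmetric])
    also have "\<dots> = exp (of_nat k * (2 * of_real pi * \<i> * of_nat p / of_nat n))"
      by (simp only: times_divide_eq_right mult_ac)
    also have "\<dots> = exp (2 * of_real pi * \<i> * of_nat p / of_nat n) ^ k"
      by (rule exp_of_nat_mult)
    finally show ?thesis by (simp only: q_def power_inverse)
  qed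
  have "q ^ n = 1"
    using complex_root_unity[of n p] assms unfolding q_def power_inverse by simp
  moreover have "q = 1 \<longleftrightarrow> n dvd p"
    using complex_root_unity_eq_1[of n p] assms unfolding q_def inverse_eq_1_iff by simp
  ultimately show ?thesis
    unfolding q by (simp add: sum_gp_strict)
qed

text \<open>This is Newton's binomial series for (1 - z/w)^(-N), after factoring (-w)^N out of (z -
  w)^N. The sign of the generalized binomial coefficient cancels that of (-z/w)^j, so only (-1)^N
  remains.\<close>

lemma inverse_power_diff_sums:
  fixes z w :: complex
  assumes w: "cmod w = 1" and z: "cmod z < 1" and N: "N \<ge> 1"
  shows "(\<lambda>j. (- 1) ^ N * of_nat ((N + j - 1) choose j) * inverse w ^ (N + j) * z ^ j) sums (1 / (z - w) ^ N)"
proof -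
  have [simp]: "w \<noteq> 0" using w by auto
  have zw: "cmod (- (z / w)) < 1" using w z by (simp add: norm_divide)
  hence ne: "1 + - (z / w) \<noteq> 0" by (auto simp: add_eq_0_iff)
  have "(- of_nat N gchoose j) * (- (z / w)) ^ j = of_nat ((N + j - 1) choose j) * (inverse w ^ j * z ^ j)" for j
  proof -
    have "of_nat N + of_nat j - 1 = (of_nat (N + j - 1) :: complex)"
      using N by (simp add: of_nat_diff)
    hence "- of_nat N gchoose j = (- 1) ^ j * (of_nat ((N + j - 1) choose j) :: complex)"
      by (simp only: gbinomial_minus binomial_gbinomial)
    moreover have "(- (z / w)) ^ j = (- 1) ^ j * (inverse w ^ j * z ^ j)"
      unfolding power_minus[of "z / w"] by (simp add: divide_inverse power_mult_distrib)
    moreover have "(- 1) ^ j * ((- 1) ^ j :: complex) = 1"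
      by (simp flip: power_mult_distrib)
    ultimately show ?thesis by (simp add: algebra_simps)
  qed
  moreover have "(1 + - (z / w)) powr (- of_nat N) = inverse ((1 + - (z / w)) ^ N)"
    using ne by (simp add: powr_minus powr_nat')
  ultimately have "(\<lambda>j. of_nat ((N + j - 1) choose j) * (inverse w ^ j * z ^ j))
      sums inverse ((1 + - (z / w)) ^ N)"
    using gen_binomial_complex[OF zw, of "- of_nat N"] by simp
  hence "(\<lambda>j. (- 1) ^ N * inverse w ^ N * (of_nat ((N + j - 1) choose j) * (inverse w ^ j * z ^ j)))
      sums ((- 1) ^ N * inverse w ^ N * inverse ((1 + - (z / w)) ^ N))"
    by (rule sums_mult)
  moreover have "(- 1) ^ N * inverse w ^ N * inverse ((1 + - (z / w)) ^ N) = 1 / (z - w) ^ N"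
  proof -
    have "z - w = (- 1) * w * (1 + - (z / w))" by (simp add: algebra_simps)
    hence "(z - w) ^ N = (- 1) ^ N * w ^ N * (1 + - (z / w)) ^ N" by (simp only: power_mult_distrib)
    thus ?thesis by (simp add: divide_inverse flip: power_inverse)
  qed
  ultimately show ?thesis by (simp add: power_add mult_ac)
qed

text \<open>Divisibility concerns \<open>N + j\<close> rather than \<open>j\<close>, because the
  factor w^(-N) taken out of each summand adds to the w^(-j) of the series.\<close>

definition Psi_coeff :: "nat \<Rightarrow> nat \<Rightarrow> nat \<Rightarrow> complex" where
  "Psi_coeff N n j =
     (- 1) ^ N * of_nat ((N + j - 1) choose j) * (if n dvd N + j then of_nat n else 0)"

lemma Psi_sums:
  assumes "N \<ge> 1" "0 < n" "cmod z < 1"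
  shows "(\<lambda>j. Psi_coeff N n j * z ^ j) sums Psi N n z"
proof -
  have "(\<lambda>j. \<Sum>k<n. (- 1) ^ N * of_nat ((N + j - 1) choose j) *
      inverse (exp (2 * of_real pi * \<i> * of_nat k / of_nat n)) ^ (N + j) * z ^ j) sums Psi N n z"
    unfolding Psi_def using assms by (intro sums_sum inverse_power_diff_sums) auto
  thus ?thesis
    by (simp only: Psi_coeff_def sum_distrib_left[symmetric] sum_distrib_right[symmetric]
        sum_root_of_unity_inverse_powers[OF \<open>0 < n\<close>])
qed

section \<open>Asymptotics of the squared norms of the terms\<close>

text \<open>For \<open>k > 0\<close> the sequence is exactly Euler's limit formula for Gamma, since
  the Pochhammer symbol in its denominator is Gamma(\<beta> + k + 1) / Gamma(\<beta>).\<close>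

lemma Beta_mult_powr_limit:
  fixes \<beta> :: real
  assumes "\<beta> > 0"
  shows "(\<lambda>k. Beta (real k + 1) \<beta> * real k powr \<beta>) \<longlonglongrightarrow> Gamma \<beta>"
proof (rule Lim_transform_eventually)
  show "Gamma_series \<beta> \<longlonglongrightarrow> Gamma \<beta>" by (rule Gamma_series_LIMSEQ)
  show "\<forall>\<^sub>F k in sequentially. Gamma_series \<beta> k = Beta (real k + 1) \<beta> * real k powr \<beta>"
    using eventually_gt_at_top[of 0]
  proof eventually_elim
    case (elim k)
    have "pochhammer \<beta> (k + 1) = Gamma (\<beta> + real (k + 1)) / Gamma \<beta>"
      using assms by (intro pochhammer_Gamma) auto
    moreover have "Gamma (real k + 1) = fact k"
      using Gamma_fact[of k, where 'a = real] by (simp add: add.commute)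
    moreover have "Gamma \<beta> \<noteq> 0" using assms by (simp add: Gamma_real_pos less_imp_neq[symmetric])
    ultimately show ?case
      using elim by (simp add: Gamma_series_def Beta_def powr_def add_ac)
  qed
qed

text \<open>For \<alpha> > -1 this is the squared Bergman norm of the \<open>j\<close>-th Taylor
  term of (1 - z)^(-N).\<close>

definition norm_weight :: "nat \<Rightarrow> real \<Rightarrow> nat \<Rightarrow> real" where
  "norm_weight N \<alpha> j = (real ((N + j - 1) choose j))\<^sup>2 * ((\<alpha> + 1) * Beta (real j + 1) (\<alpha> + 1))"

text \<open>The binomial coefficient is asymptotic to k^(N - 1) / (N - 1)!, and the Beta value to
  Gamma(\<alpha> + 1) k^(-\<alpha> - 1). The power is taken of \<open>N + k\<close> instead of
  \<open>k\<close> because at the indices used later \<open>N + k\<close> is exactly a multiple of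
  \<open>n\<close>; the price is the factor (1 + N/k)^s, which tends to 1.\<close>

lemma norm_weight_asymptotics:
  fixes \<alpha> :: real
  assumes N: "N \<ge> 1" and \<alpha>: "\<alpha> > - 1"
  shows "(\<lambda>k. norm_weight N \<alpha> k * real (N + k) powr (\<alpha> + 3 - 2 * real N)) \<longlonglongrightarrow> Gamma (\<alpha> + 2) / (fact (N - 1))\<^sup>2"
proof (rule Lim_transform_eventually)
  let ?s = "\<alpha> + 3 - 2 * real N"
  have "(\<lambda>k. 1 + real N / real k) \<longlonglongrightarrow> 1 + 0"
    by (intro tendsto_intros real_tendsto_divide_at_top[OF tendsto_const] filterlim_real_sequentially)
  hence shift: "(\<lambda>k. (1 + real N / real k) powr ?s) \<longlonglongrightarrow> 1 powr ?s"
    by (intro tendsto_powr tendsto_const) auto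
  have "(\<lambda>k. (real ((N - 1 + k) choose k) / real (k ^ (N - 1)))\<^sup>2 *
        ((\<alpha> + 1) * (Beta (real k + 1) (\<alpha> + 1) * real k powr (\<alpha> + 1))) * (1 + real N / real k) powr ?s)
      \<longlonglongrightarrow> (1 / fact (N - 1))\<^sup>2 * ((\<alpha> + 1) * Gamma (\<alpha> + 1)) * 1 powr ?s"
    using \<alpha> by (intro tendsto_mult tendsto_power tendsto_const fact_binomial_limit Beta_mult_powr_limit shift) auto
  moreover have "(\<alpha> + 1) * Gamma (\<alpha> + 1) = Gamma (\<alpha> + 2)"
    using Gamma_plus1[of "\<alpha> + 1"] \<alpha> by (force simp: add_ac elim!: nonpos_Ints_cases)
  ultimately show "(\<lambda>k. (real ((N - 1 + k) choose k) / real (k ^ (N - 1)))\<^sup>2 *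
        ((\<alpha> + 1) * (Beta (real k + 1) (\<alpha> + 1) * real k powr (\<alpha> + 1))) * (1 + real N / real k) powr ?s)
      \<longlonglongrightarrow> Gamma (\<alpha> + 2) / (fact (N - 1))\<^sup>2"
    by (simp add: power_divide)
  show "\<forall>\<^sub>F k in sequentially. (real ((N - 1 + k) choose k) / real (k ^ (N - 1)))\<^sup>2 *
        ((\<alpha> + 1) * (Beta (real k + 1) (\<alpha> + 1) * real k powr (\<alpha> + 1))) * (1 + real N / real k) powr ?s
      = norm_weight N \<alpha> k * real (N + k) powr ?s"
    using eventually_gt_at_top[of 0]
  proof eventually_elim
    case (elim k)
    have "real (N + k) powr ?s = (real k * (1 + real N / real k)) powr ?s"
      using elim by (simp add: distrib_left add.commute)
    also have "\<dots> = real k powr ?s * (1 + real N / real k) powr ?s"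
      by (rule powr_mult)
    also have "real k powr ?s = real k powr (\<alpha> + 1) / (real (k ^ (N - 1)))\<^sup>2"
    proof -
      have "(real (k ^ (N - 1)))\<^sup>2 = real k powr (2 * (real N - 1))"
        using elim N by (simp add: powr_realpow[symmetric] powr_powr of_nat_diff mult_ac)
      thus ?thesis by (simp add: powr_diff[symmetric] algebra_simps)
    qed
    finally show ?case using N by (simp add: norm_weight_def power_divide)
  qed
qed

lemma Beta_real_nonneg: "0 < a \<Longrightarrow> 0 < b \<Longrightarrow> 0 \<le> Beta a (b :: real)"
  unfolding Beta_def by (intro mult_nonneg_nonneg divide_nonneg_nonneg Gamma_real_nonneg) auto

lemma norm_weight_nonneg: "\<alpha> > - 1 \<Longrightarrow> 0 \<le> norm_weight N \<alpha> j"
  unfolding norm_weight_def by (intro mult_nonneg_nonneg Beta_real_nonneg) auto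

section \<open>The Bergman norm of \<open>Psi\<close> as a series\<close>

lemma bergman_norm_sq_Psi:
  assumes N: "N \<ge> 1" and n: "0 < n" and \<alpha>: "\<alpha> > - 1"
  shows "bergman_norm_sq \<alpha> (Psi N n)
       = (\<Sum>j. ennreal (if n dvd N + j then (real n)\<^sup>2 * norm_weight N \<alpha> j else 0))"
proof -
  let ?a = "Psi_coeff N n"
  have Beta: "0 \<le> Beta (real j + 1) (\<alpha> + 1)" for j
    using \<alpha> by (intro Beta_real_nonneg) auto
  have "(\<integral>\<^sup>+ z. ennreal ((cmod (Psi N n z))\<^sup>2 * (1 - (cmod z)\<^sup>2) powr \<alpha>) \<partial>disc_area)
      = (\<integral>\<^sup>+ z. ennreal ((cmod (\<Sum>j. ?a j * z ^ j))\<^sup>2 * (1 - (cmod z)\<^sup>2) powr \<alpha>) \<partial>disc_area)"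
  proof (rule nn_integral_cong_AE, use AE_disc_area in eventually_elim)
    fix z assume "cmod z < 1"
    thus "ennreal ((cmod (Psi N n z))\<^sup>2 * (1 - (cmod z)\<^sup>2) powr \<alpha>)
        = ennreal ((cmod (\<Sum>j. ?a j * z ^ j))\<^sup>2 * (1 - (cmod z)\<^sup>2) powr \<alpha>)"
      using sums_unique[OF Psi_sums[OF N n]] by simp
  qed
  also have "\<dots> = (\<Sum>j. ennreal ((cmod (?a j))\<^sup>2) *
      (\<integral>\<^sup>+ z. ennreal ((cmod z) ^ (2 * j) * (1 - (cmod z)\<^sup>2) powr \<alpha>) \<partial>disc_area))"
    by (rule parseval_disc) (use Psi_sums[OF N n] in \<open>auto simp: summable_def\<close>)
  also have "\<dots> = (\<Sum>j. ennreal ((cmod (?a j))\<^sup>2 * Beta (real j + 1) (\<alpha> + 1)))"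
    by (simp only: disc_moment[OF \<alpha>] ennreal_mult[OF zero_le_power2 Beta])
  finally have "bergman_norm_sq \<alpha> (Psi N n)
      = (\<Sum>j. ennreal (\<alpha> + 1) * ennreal ((cmod (?a j))\<^sup>2 * Beta (real j + 1) (\<alpha> + 1)))"
    unfolding bergman_norm_sq_def by simp
  also have "\<dots> = (\<Sum>j. ennreal (if n dvd N + j then (real n)\<^sup>2 * norm_weight N \<alpha> j else 0))"
  proof (intro suminf_cong)
    fix j
    have "ennreal (\<alpha> + 1) * ennreal ((cmod (?a j))\<^sup>2 * Beta (real j + 1) (\<alpha> + 1))
        = ennreal ((\<alpha> + 1) * ((cmod (?a j))\<^sup>2 * Beta (real j + 1) (\<alpha> + 1)))"
      using \<alpha> Beta[of j] by (intro ennreal_mult[symmetric]) auto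
    also have "(\<alpha> + 1) * ((cmod (?a j))\<^sup>2 * Beta (real j + 1) (\<alpha> + 1))
        = (if n dvd N + j then (real n)\<^sup>2 * norm_weight N \<alpha> j else 0)"
      by (simp add: Psi_coeff_def norm_weight_def norm_mult norm_power power_mult_distrib)
    finally show "ennreal (\<alpha> + 1) * ennreal ((cmod (?a j))\<^sup>2 * Beta (real j + 1) (\<alpha> + 1))
        = ennreal (if n dvd N + j then (real n)\<^sup>2 * norm_weight N \<alpha> j else 0)" .
  qed
  finally show ?thesis .
qed

text \<open>The indices \<open>j\<close> with \<open>n dvd N + j\<close> are reindexed by the
  positive multiples of \<open>n\<close>. The condition \<open>N \<le> n\<close> keeps the natural
  subtraction exact already at the first multiple.\<close>

lemma bergman_norm_sq_Psi_lacunary: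
  assumes N: "N \<ge> 1" and n: "N \<le> n" and \<alpha>: "\<alpha> > - 1"
  shows "bergman_norm_sq \<alpha> (Psi N n) = (\<Sum>m. ennreal ((real n)\<^sup>2 * norm_weight N \<alpha> (n * Suc m - N)))"
proof -
  define g where "g m = n * Suc m - N" for m
  have le: "N \<le> n * Suc m" for m using n by (simp add: trans_le_add1)
  have dvd: "n dvd N + g m" for m using le[of m] by (simp add: g_def)
  have mono: "strict_mono g"
  proof (rule strict_monoI)
    fix m m' :: nat assume "m < m'"
    hence "n * Suc m < n * Suc m'" using N n by (intro mult_strict_left_mono) auto
    thus "g m < g m'" using le[of m] unfolding g_def by linarith
  qed
  have range: "j \<in> range g" if "n dvd N + j" for j
  proof -
    from that obtain k where k: "N + j = n * k" by (rule dvdE)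
    hence "k \<noteq> 0" using N by (intro notI) simp
    then obtain m where "k = Suc m" using not0_implies_Suc by blast
    hence "j = g m" using k unfolding g_def by (metis diff_add_inverse)
    thus ?thesis by blast
  qed
  let ?f = "\<lambda>j. ennreal (if n dvd N + j then (real n)\<^sup>2 * norm_weight N \<alpha> j else 0)"
  have "(\<Sum>m. ?f (g m)) = (\<Sum>j. ?f j)"
    by (rule suminf_mono_reindex[OF mono]) (use range in auto)
  thus ?thesis
    using bergman_norm_sq_Psi[OF N _ \<alpha>, of n] N n dvd by (simp add: g_def)
qed

section \<open>Passage to the limit\<close>

theorem theorem1p5:
  fixes N :: nat and \<alpha> :: real
  assumes "N \<ge> 1" and "\<alpha> > 2 * (real N - 1)"
  shows "(\<lambda>n. ennreal (real n powr (\<alpha> + 1 - 2 * real N)) * bergman_norm_sq \<alpha> (Psi N n))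
           \<longlonglongrightarrow> ennreal (Gamma (\<alpha> + 2) * zeta (\<alpha> + 1 - 2 * (real N - 1)) / (fact (N - 1))\<^sup>2)"
proof -
  \<comment> \<open>This is the argument of \<open>zeta\<close> in the claim, and the hypothesis on
    \<alpha> is the same as \<open>s > 1\<close>.\<close>
  define s where "s = \<alpha> + 3 - 2 * real N"
  define L where "L = Gamma (\<alpha> + 2) / (fact (N - 1))\<^sup>2"
  define t where "t j = norm_weight N \<alpha> j * real (N + j) powr s" for j
  define c where "c m n = t (n * Suc m - N) * (1 / real (Suc m) powr s)" for m n
  have N: "N \<ge> 1" by fact
  have \<alpha>: "\<alpha> > - 1" using assms by simp
  have s: "s > 1" using assms by (simp add: s_def)
  have t0: "0 \<le> t j" for j
    using norm_weight_nonneg[OF \<alpha>] by (simp add: t_def)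
  have t_lim: "t \<longlonglongrightarrow> L"
    using norm_weight_asymptotics[OF N \<alpha>] unfolding t_def L_def s_def .
  then obtain B where B: "\<And>j. norm (t j) \<le> B"
    using convergentI convergent_imp_Bseq Bseq_def by metis
  have "summable (\<lambda>m. real m powr - s)"
    using s by (simp add: summable_real_powr_iff)
  hence summable: "summable (\<lambda>m. 1 / real (Suc m) powr s)"
    by (subst (asm) summable_Suc_iff[symmetric]) (simp only: powr_minus_divide)
  have "(\<lambda>n. c m n) \<longlonglongrightarrow> L * (1 / real (Suc m) powr s)" for m
  proof -
    have "filterlim (\<lambda>n. n * Suc m - N) at_top sequentially"
      unfolding filterlim_at_top
    proof
      fix Z
      show "\<forall>\<^sub>F n in sequentially. Z \<le> n * Suc m - N"
        using eventually_ge_at_top[of "Z + N"] by eventually_elim (simp add: le_diff_conv2)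
    qed
    thus ?thesis
      unfolding c_def by (intro tendsto_mult tendsto_const filterlim_compose[OF t_lim])
  qed
  \<comment> \<open>The majorant required by Tannery's theorem. It holds for every \<open>n\<close>,
    even where \<open>n * Suc m - N\<close> truncates to 0, because \<open>B\<close> bounds all
    values of \<open>t\<close>.\<close>
  moreover have bound: "norm (c m n) \<le> B * (1 / real (Suc m) powr s)" for m n
    using B[of "n * Suc m - N"] unfolding c_def norm_mult by (intro mult_mono) (auto intro: order_trans[OF norm_ge_zero B])
  ultimately have "((\<lambda>n. \<Sum>m. c m n) \<longlonglongrightarrow> (\<Sum>m. L * (1 / real (Suc m) powr s)))"
    using tannerys_theorem[where a = c and b = "\<lambda>m. L * (1 / real (Suc m) powr s)"
        and M = "\<lambda>m. B * (1 / real (Suc m) powr s)" and F = sequentially] summable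
    by (simp add: summable_mult case_prod_unfold del: of_nat_Suc times_divide_eq_right mult_1_right)
  also have "(\<Sum>m. L * (1 / real (Suc m) powr s)) = Gamma (\<alpha> + 2) * zeta (\<alpha> + 1 - 2 * (real N - 1)) / (fact (N - 1))\<^sup>2"
    using suminf_mult[OF summable, of L] by (simp add: zeta_def s_def L_def algebra_simps)
  finally have "(\<lambda>n. ennreal (\<Sum>m. c m n))
      \<longlonglongrightarrow> ennreal (Gamma (\<alpha> + 2) * zeta (\<alpha> + 1 - 2 * (real N - 1)) / (fact (N - 1))\<^sup>2)"
    by (rule tendsto_ennrealI)
  moreover have "\<forall>\<^sub>F n in sequentially. ennreal (\<Sum>m. c m n)
      = ennreal (real n powr (\<alpha> + 1 - 2 * real N)) * bergman_norm_sq \<alpha> (Psi N n)"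
    \<comment> \<open>From \<open>n = N\<close> on the lacunary formula applies. Its factor n^2
      combines with the normalizing power to n^s, since \<alpha> + 1 - 2N + 2 = s.\<close>
    using eventually_ge_at_top[of N]
  proof eventually_elim
    case (elim n)
    have n: "0 < real n" using N elim by simp
    have "c m n = real n powr (\<alpha> + 1 - 2 * real N) * ((real n)\<^sup>2 * norm_weight N \<alpha> (n * Suc m - N))" for m
    proof -
      have "N \<le> n * Suc m" using elim by (simp add: trans_le_add1)
      hence "real (N + (n * Suc m - N)) powr s = real n powr s * real (Suc m) powr s"
        by (simp add: powr_mult del: of_nat_Suc mult_Suc_right)
      moreover have "real n powr s = real n powr (\<alpha> + 1 - 2 * real N) * (real n)\<^sup>2"
        using n by (simp add: s_def powr_add[symmetric] flip: powr_numeral) (simp add: algebra_simps)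
      ultimately show ?thesis by (simp add: c_def t_def del: of_nat_Suc mult_Suc_right)
    qed
    hence "ennreal (real n powr (\<alpha> + 1 - 2 * real N)) * bergman_norm_sq \<alpha> (Psi N n) = (\<Sum>m. ennreal (c m n))"
      using norm_weight_nonneg[OF \<alpha>]
      by (simp add: bergman_norm_sq_Psi_lacunary[OF N elim \<alpha>] ennreal_mult del: mult_Suc_right flip: ennreal_suminf_cmult)
    also have "\<dots> = ennreal (\<Sum>m. c m n)"
    proof (rule suminf_ennreal2)
      show "0 \<le> c m n" for m using t0 by (simp add: c_def)
      show "summable (\<lambda>m. c m n)"
        by (rule summable_comparison_test'[OF summable_mult[OF summable, of B]]) (use bound in auto)
    qed
    finally show ?case by simp
  qed
  ultimately show ?thesis by (rule Lim_transform_eventually)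
qed

end
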